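(* Let $\mathbf{A}$ be a finite strictly $5$-polynomially rich Mal'cev algebra. Then $\mathbf{A}$ is strictly affine complete.
   Context: Algebras are in the sense of universal algebra: $\mathbf{A}$ has a universe $A$ and a set of basic operations. A $k$-ary polynomial function of $\mathbf{A}$ is a function $A^k\to A$ obtained by composing projections, constants from $A$ and basic operations of $\mathbf{A}$. A Mal'cev algebra is an algebra with a ternary term operation $d$ satisfying $d(a,b,b)=d(b,b,a)=a$ for all $a,b\in A$. $\operatorname{Con}\mathbf{A}$ is the congruence lattice; $\alpha\prec\beta$ means that $\beta$ covers $\alpha$ (then $\langle\alpha,\beta\rangle$ is a prime quotient); $[\cdot,\cdot]$ is the (term condition) commutator of congruences. A partial function $f\colon T\to A$ with $T\subseteq A^k$ preserves a relation $B\subseteq A^n$ if, whenever $t^{(1)},\dots,t^{(n)}\in T$ satisfy $(t^{(1)}_j,\dots,t^{(n)}_j)\in B$ for every $j\le k$, then $(f(t^{(1)}),\dots,f(t^{(n)}))\in B$. It is congruence-preserving if it preserves all congruences of $\mathbf{A}$. A finite algebra $\mathbf{A}$ is strictly affine complete if for every $k\in\mathbb{N}$, every $T\subseteq A^k$ and every congruence-preserving $f\colon T\to A$ there is a $k$-ary polynomial function $p$ with $p|_T=f$. For a prime quotient $\langle\alpha,\beta\rangle$ of a finite Mal'cev algebra with $[\beta,\beta]\le\alpha$ (equivalently, of type $\mathbf{2}$) let $\rho(\alpha,\beta)=\{(a_1,a_2,a_3,a_4)\in A^4\mid a_1\,\beta\,a_2\,\beta\,a_3,\ d(a_1,a_2,a_3)\,\alpha\,a_4\}$.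 A partial function is type-preserving if it is congruence-preserving and preserves $\rho(\alpha,\beta)$ for every such prime quotient. $\mathbf{A}$ is strictly $k$-polynomially rich if for every $T\subseteq A^k$ and every type-preserving $f\colon T\to A$ there is a $k$-ary polynomial function $p$ of $\mathbf{A}$ with $p|_T=f$. *)

theory Defs
  imports Main
begin

text \<open>
  Tuples are lists, and a \<open>k\<close>-ary operation on the universe is a function on lists of which only
  the values at tuples of length \<open>k\<close> over the universe matter. A basic operation is stored
  together with its arity; arity 0 is allowed.
\<close>

record 'a ualgebra =
  universe :: "'a set"
  basic_ops :: "(nat \<times> ('a list \<Rightarrow> 'a)) set"

definition tuples :: "'a set \<Rightarrow> nat \<Rightarrow> 'a list set" where
  "tuples S k = {xs. length xs = k \<and> set xs \<subseteq> S}"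

definition universal_algebra :: "'a ualgebra \<Rightarrow> bool" where
  "universal_algebra A \<longleftrightarrow> universe A \<noteq> {} \<and>
     (\<forall>(n, f) \<in> basic_ops A. \<forall>xs \<in> tuples (universe A) n. f xs \<in> universe A)"

inductive_set term_ops :: "'a ualgebra \<Rightarrow> nat \<Rightarrow> ('a list \<Rightarrow> 'a) set"
  for A :: "'a ualgebra" and k :: nat where
  proj: "i < k \<Longrightarrow> (\<lambda>xs. xs ! i) \<in> term_ops A k"
| comp: "(n, f) \<in> basic_ops A \<Longrightarrow> length gs = n \<Longrightarrow> \<forall>g \<in> set gs. g \<in> term_ops A k
    \<Longrightarrow> (\<lambda>xs. f (map (\<lambda>g. g xs) gs)) \<in> term_ops A k"

inductive_set poly_funs :: "'a ualgebra \<Rightarrow> nat \<Rightarrow> ('a list \<Rightarrow> 'a) set"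
  for A :: "'a ualgebra" and k :: nat where
  proj: "i < k \<Longrightarrow> (\<lambda>xs. xs ! i) \<in> poly_funs A k"
| const: "c \<in> universe A \<Longrightarrow> (\<lambda>xs. c) \<in> poly_funs A k"
| comp: "(n, f) \<in> basic_ops A \<Longrightarrow> length gs = n \<Longrightarrow> \<forall>g \<in> set gs. g \<in> poly_funs A k
    \<Longrightarrow> (\<lambda>xs. f (map (\<lambda>g. g xs) gs)) \<in> poly_funs A k"

definition malcev_term_op :: "'a ualgebra \<Rightarrow> ('a list \<Rightarrow> 'a) \<Rightarrow> bool" where
  "malcev_term_op A d \<longleftrightarrow> d \<in> term_ops A 3 \<and>
     (\<forall>a \<in> universe A. \<forall>b \<in> universe A. d [a, b, b] = a \<and> d [b, b, a] = a)"

definition Con :: "'a ualgebra \<Rightarrow> 'a rel set" where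
  "Con A = {\<theta>. equiv (universe A) \<theta> \<and>
     (\<forall>(n, f) \<in> basic_ops A. \<forall>xs \<in> tuples (universe A) n. \<forall>ys \<in> tuples (universe A) n.
        (\<forall>i<n. (xs ! i, ys ! i) \<in> \<theta>) \<longrightarrow> (f xs, f ys) \<in> \<theta>)}"

definition covers :: "'a ualgebra \<Rightarrow> 'a rel \<Rightarrow> 'a rel \<Rightarrow> bool" where
  "covers A \<alpha> \<beta> \<longleftrightarrow> \<alpha> \<in> Con A \<and> \<beta> \<in> Con A \<and> \<alpha> \<subset> \<beta> \<and> \<not> (\<exists>\<gamma> \<in> Con A. \<alpha> \<subset> \<gamma> \<and> \<gamma> \<subset> \<beta>)"

text \<open>The term condition \<open>C(\<alpha>, \<beta>; \<delta>)\<close>.\<close>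

definition centralizes :: "'a ualgebra \<Rightarrow> 'a rel \<Rightarrow> 'a rel \<Rightarrow> 'a rel \<Rightarrow> bool" where
  "centralizes A \<alpha> \<beta> \<delta> \<longleftrightarrow>
     (\<forall>m n. \<forall>t \<in> term_ops A (m + n).
        \<forall>a \<in> tuples (universe A) m. \<forall>b \<in> tuples (universe A) m.
        \<forall>u \<in> tuples (universe A) n. \<forall>v \<in> tuples (universe A) n.
          (\<forall>i<m. (a ! i, b ! i) \<in> \<alpha>) \<longrightarrow> (\<forall>i<n. (u ! i, v ! i) \<in> \<beta>) \<longrightarrow>
          (t (a @ u), t (a @ v)) \<in> \<delta> \<longrightarrow> (t (b @ u), t (b @ v)) \<in> \<delta>)"

text \<open>
  The congruences satisfying the term condition are closed under intersection and include the
  full relation, so this intersection is the least of them.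
\<close>

definition commutator :: "'a ualgebra \<Rightarrow> 'a rel \<Rightarrow> 'a rel \<Rightarrow> 'a rel" where
  "commutator A \<alpha> \<beta> = \<Inter> {\<delta> \<in> Con A. centralizes A \<alpha> \<beta> \<delta>}"

text \<open>
  A partial function with domain \<open>T\<close> is a total function of which only the values on \<open>T\<close> are used.
  A relation of arity \<open>n\<close> is a set of lists of length \<open>n\<close>.
\<close>

definition preserves :: "nat \<Rightarrow> 'a list set \<Rightarrow> ('a list \<Rightarrow> 'a) \<Rightarrow> nat \<Rightarrow> 'a list set \<Rightarrow> bool" where
  "preserves k T f n B \<longleftrightarrow>
     (\<forall>ts \<in> tuples T n. (\<forall>j<k. map (\<lambda>t. t ! j) ts \<in> B) \<longrightarrow> map f ts \<in> B)"

definition congruence_preserving ::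
  "'a ualgebra \<Rightarrow> nat \<Rightarrow> 'a list set \<Rightarrow> ('a list \<Rightarrow> 'a) \<Rightarrow> bool" where
  "congruence_preserving A k T f \<longleftrightarrow>
     (\<forall>\<theta> \<in> Con A. preserves k T f 2 {[a, b] | a b. (a, b) \<in> \<theta>})"

definition rho :: "('a list \<Rightarrow> 'a) \<Rightarrow> 'a rel \<Rightarrow> 'a rel \<Rightarrow> 'a list set" where
  "rho d \<alpha> \<beta> = {[a1, a2, a3, a4] | a1 a2 a3 a4.
     (a1, a2) \<in> \<beta> \<and> (a2, a3) \<in> \<beta> \<and> (d [a1, a2, a3], a4) \<in> \<alpha>}"

definition type_preserving ::
  "'a ualgebra \<Rightarrow> ('a list \<Rightarrow> 'a) \<Rightarrow> nat \<Rightarrow> 'a list set \<Rightarrow> ('a list \<Rightarrow> 'a) \<Rightarrow> bool" where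
  "type_preserving A d k T f \<longleftrightarrow> congruence_preserving A k T f \<and>
     (\<forall>\<alpha> \<beta>. covers A \<alpha> \<beta> \<and> commutator A \<beta> \<beta> \<subseteq> \<alpha> \<longrightarrow> preserves k T f 4 (rho d \<alpha> \<beta>))"

definition strictly_affine_complete :: "'a ualgebra \<Rightarrow> bool" where
  "strictly_affine_complete A \<longleftrightarrow>
     (\<forall>k T f. T \<subseteq> tuples (universe A) k \<and> f ` T \<subseteq> universe A \<and> congruence_preserving A k T f \<longrightarrow>
        (\<exists>p \<in> poly_funs A k. \<forall>x \<in> T. p x = f x))"

definition strictly_polynomially_rich ::
  "'a ualgebra \<Rightarrow> ('a list \<Rightarrow> 'a) \<Rightarrow> nat \<Rightarrow> bool" where
  "strictly_polynomially_rich A d k \<longleftrightarrow>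
     (\<forall>T f. T \<subseteq> tuples (universe A) k \<and> f ` T \<subseteq> universe A \<and> type_preserving A d k T f \<longrightarrow>
        (\<exists>p \<in> poly_funs A k. \<forall>x \<in> T. p x = f x))"

end

theory Submission
  imports Defs
begin

text \<open>
  Let \<open>\<alpha>\<close> be covered by \<open>\<beta>\<close> with \<open>[\<beta>, \<beta>] \<le> \<alpha>\<close>. Inside a \<open>\<beta>\<close>-class, taken modulo \<open>\<alpha>\<close>,
  \<open>d(x, y, z)\<close> is \<open>x - y + z\<close> in an abelian group and every polynomial function is affine
  (\<open>abelian_poly_affine\<close>). Besides preservation of congruences, type-preservation asks only for the
  affine relations \<open>x - y + z = w\<close> between four points of its domain, and five variables leave
  room for a domain on which this is too little: choose \<open>(a, b) \<in> \<beta> - \<alpha>\<close>, read \<open>a\<close> as zero, let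
  \<open>e\<^sub>0, \<dots>, e\<^sub>4\<close> be the tuples with a single entry \<open>b\<close>, and let
  \<open>s = e\<^sub>0 - e\<^sub>1 + e\<^sub>2 - e\<^sub>3 + e\<^sub>4\<close>. The function with value \<open>a\<close> at every \<open>e\<^sub>i\<close> and \<open>b\<close> at \<open>s\<close> violates
  this relation between six points, so it is not polynomial, but it is type-preserving
  (\<open>six_fun_type_preserving\<close>). Hence a strictly 5-polynomially rich algebra has no such quotient
  (\<open>rich_no_abelian_cover\<close>).

  Type-preserving then means congruence-preserving. The majority function, defined on the triples
  with a repeated entry, preserves every binary relation, so it is a polynomial
  (\<open>rich_majority_polynomial\<close>). By the argument of Baker and Pixley a majority polynomial reduces
  interpolation on a finite set to interpolation on two points (\<open>majority_interpolation\<close>). On two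
  points \<open>t, s\<close> the pairs \<open>(p t, p s)\<close> with \<open>p\<close> polynomial form a reflexive subalgebra of \<open>A\<^sup>2\<close>,
  which in a Mal'cev algebra is a congruence, so a congruence-preserving function can be
  interpolated there (\<open>two_point_interpolation\<close>).
\<close>

section \<open>Polynomial functions and congruences\<close>

lemma tuples_iff: "xs \<in> tuples S k \<longleftrightarrow> length xs = k \<and> (\<forall>i<k. xs ! i \<in> S)"
  by (fastforce simp: tuples_def in_set_conv_nth)

lemma poly_funs_compose:
  assumes "p \<in> poly_funs A n" "length gs = n" "\<forall>g \<in> set gs. g \<in> poly_funs A k"
  shows "(\<lambda>xs. p (map (\<lambda>g. g xs) gs)) \<in> poly_funs A k"
  using assms(1)
proof induction
  case (proj i)
  then have "(\<lambda>xs. map (\<lambda>g. g xs) gs ! i) = gs ! i"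
    using assms(2) by auto
  then show ?case using proj assms by auto
next
  case (const c)
  then show ?case by (rule poly_funs.const)
next
  case (comp m f hs)
  have "(\<lambda>xs. f (map (\<lambda>g. g xs) (map (\<lambda>h xs. h (map (\<lambda>g. g xs) gs)) hs))) \<in> poly_funs A k"
    by (rule poly_funs.comp[OF comp(1)]) (use comp in auto)
  then show ?case by (simp add: comp_def)
qed

lemma poly_funs_compose3:
  assumes "p \<in> poly_funs A 3" "g1 \<in> poly_funs A k" "g2 \<in> poly_funs A k" "g3 \<in> poly_funs A k"
  shows "(\<lambda>xs. p [g1 xs, g2 xs, g3 xs]) \<in> poly_funs A k"
  using poly_funs_compose[OF assms(1), of "[g1, g2, g3]" k] assms by simp

lemma term_op_is_poly_fun: "t \<in> term_ops A k \<Longrightarrow> t \<in> poly_funs A k"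
  by (induction rule: term_ops.induct) (auto intro: poly_funs.intros)

lemma poly_funs_closed:
  assumes "universal_algebra A" "p \<in> poly_funs A k" "xs \<in> tuples (universe A) k"
  shows "p xs \<in> universe A"
  using assms(2)
proof induction
  case (proj i)
  then show ?case using assms(3) by (simp add: tuples_iff)
next
  case (const c)
  then show ?case by simp
next
  case (comp n f gs)
  then have "map (\<lambda>g. g xs) gs \<in> tuples (universe A) n"
    by (auto simp: tuples_def)
  then show ?case using assms(1) comp(1) by (auto simp: universal_algebra_def)
qed

lemma Con_subset: "\<theta> \<in> Con A \<Longrightarrow> (x, y) \<in> \<theta> \<Longrightarrow> x \<in> universe A \<and> y \<in> universe A"
  by (auto simp: Con_def dest: equiv_type)

lemma Con_refl: "\<theta> \<in> Con A \<Longrightarrow> x \<in> universe A \<Longrightarrow> (x, x) \<in> \<theta>"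
  by (auto simp: Con_def equiv_def refl_on_def)

lemma Con_sym: "\<theta> \<in> Con A \<Longrightarrow> (x, y) \<in> \<theta> \<Longrightarrow> (y, x) \<in> \<theta>"
  by (auto simp: Con_def equiv_def dest: symD)

lemma Con_trans: "\<theta> \<in> Con A \<Longrightarrow> (x, y) \<in> \<theta> \<Longrightarrow> (y, z) \<in> \<theta> \<Longrightarrow> (x, z) \<in> \<theta>"
  by (auto simp: Con_def equiv_def dest: transD)

lemma poly_funs_cong:
  assumes "universal_algebra A" "\<theta> \<in> Con A" "p \<in> poly_funs A k"
    and "xs \<in> tuples (universe A) k" "ys \<in> tuples (universe A) k"
    and "\<forall>i<k. (xs ! i, ys ! i) \<in> \<theta>"
  shows "(p xs, p ys) \<in> \<theta>"
  using assms(3)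
proof induction
  case (proj i)
  then show ?case using assms by simp
next
  case (const c)
  then show ?case using Con_refl[OF assms(2)] by simp
next
  case (comp n f gs)
  have "map (\<lambda>g. g xs) gs \<in> tuples (universe A) n" "map (\<lambda>g. g ys) gs \<in> tuples (universe A) n"
    using comp poly_funs_closed[OF assms(1)] assms(4,5) by (auto simp: tuples_def)
  moreover have "\<forall>i<n. (map (\<lambda>g. g xs) gs ! i, map (\<lambda>g. g ys) gs ! i) \<in> \<theta>"
    using comp by auto
  ultimately show ?case using assms(2) comp(1) unfolding Con_def by fast
qed

section \<open>The term condition through matrices\<close>

text \<open>
  The 2 by 2 matrices \<open>t(x\<^sub>i, y\<^sub>j)\<close> whose row index switches some arguments of a term and whose
  column index switches the others, each within a \<open>\<beta>\<close>-class. Generating them as a subalgebra turns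
  the term condition into a statement without terms and tuples: modulo \<open>\<delta>\<close>, equality of the entries
  in one row implies equality of the entries in the other row.
\<close>

inductive_set matrices :: "'a ualgebra \<Rightarrow> 'a rel \<Rightarrow> (bool \<Rightarrow> bool \<Rightarrow> 'a) set"
  for A :: "'a ualgebra" and \<beta> :: "'a rel" where
  row: "(x, y) \<in> \<beta> \<Longrightarrow> (\<lambda>i j. if i then y else x) \<in> matrices A \<beta>"
| col: "(x, y) \<in> \<beta> \<Longrightarrow> (\<lambda>i j. if j then y else x) \<in> matrices A \<beta>"
| comp: "(n, f) \<in> basic_ops A \<Longrightarrow> length hs = n \<Longrightarrow> \<forall>h \<in> set hs. h \<in> matrices A \<beta>
    \<Longrightarrow> (\<lambda>i j. f (map (\<lambda>h. h i j) hs)) \<in> matrices A \<beta>"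

lemma matrices_const:
  assumes "\<beta> \<in> Con A" "x \<in> universe A"
  shows "(\<lambda>i j. x) \<in> matrices A \<beta>"
  using matrices.row[of x x \<beta> A] Con_refl[OF assms] by simp

lemma matrices_poly:
  assumes "\<beta> \<in> Con A" "p \<in> poly_funs A n" "length hs = n" "\<forall>h \<in> set hs. h \<in> matrices A \<beta>"
  shows "(\<lambda>i j. p (map (\<lambda>h. h i j) hs)) \<in> matrices A \<beta>"
  using assms(2)
proof induction
  case (proj l)
  then have "(\<lambda>i j. map (\<lambda>h. h i j) hs ! l) = hs ! l"
    using assms(3) by auto
  then show ?case using proj assms by auto
next
  case (const c)
  then show ?case using matrices_const[OF assms(1)] by simp
next
  case (comp m f gs)
  have "(\<lambda>i j. f (map (\<lambda>h. h i j) (map (\<lambda>g i j. g (map (\<lambda>h. h i j) hs)) gs))) \<in> matrices A \<beta>"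
    by (rule matrices.comp[OF comp(1)]) (use comp in auto)
  then show ?case by (simp add: comp_def)
qed

lemma matrices_poly3:
  assumes "\<beta> \<in> Con A" "p \<in> poly_funs A 3"
    and "h1 \<in> matrices A \<beta>" "h2 \<in> matrices A \<beta>" "h3 \<in> matrices A \<beta>"
  shows "(\<lambda>i j. p [h1 i j, h2 i j, h3 i j]) \<in> matrices A \<beta>"
  using matrices_poly[OF assms(1,2), of "[h1, h2, h3]"] assms by simp

lemma matrices_closed:
  assumes "universal_algebra A" "\<beta> \<in> Con A" "h \<in> matrices A \<beta>"
  shows "h i j \<in> universe A"
  using assms(3)
proof induction
  case (comp n f hs)
  then have "map (\<lambda>h. h i j) hs \<in> tuples (universe A) n"
    by (auto simp: tuples_def)
  then show ?case using assms(1) comp(1) by (auto simp: universal_algebra_def)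
qed (use Con_subset[OF assms(2)] in auto)

text \<open>
  Together with the constant matrices, this makes it possible to subtract from a matrix its own
  first row.
\<close>

lemma matrices_repeat_row:
  assumes "\<beta> \<in> Con A" "h \<in> matrices A \<beta>"
  shows "(\<lambda>i j. h False j) \<in> matrices A \<beta>"
  using assms(2)
proof induction
  case (row x y)
  then show ?case using matrices_const[OF assms(1)] Con_subset[OF assms(1)] by simp
next
  case (col x y)
  then show ?case by (simp add: matrices.col)
next
  case (comp n f hs)
  have "(\<lambda>i j. f (map (\<lambda>h. h i j) (map (\<lambda>h i j. h False j) hs))) \<in> matrices A \<beta>"
    by (rule matrices.comp[OF comp(1)]) (use comp in auto)
  then show ?case by (simp add: comp_def)
qed

text \<open>
  The list \<open>L\<close> enumerates all of \<open>\<beta>\<close>, so a single pair of tuples serves for every matrix. The terms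
  that represent the arguments of a basic operation therefore have the same variables and can be
  composed directly.
\<close>

lemma matrices_uniform_term:
  assumes "set L = \<beta>" "h \<in> matrices A \<beta>"
  defines "r \<equiv> \<lambda>i. map (if i then snd else fst) L"
  shows "\<exists>t \<in> term_ops A (length L + length L). \<forall>i j. h i j = t (r i @ r j)"
  using assms(2)
proof induction
  case (row x y)
  then obtain l where l: "l < length L" "L ! l = (x, y)"
    using assms(1) by (auto simp: in_set_conv_nth)
  show ?case
    by (rule bexI[OF _ term_ops.proj[of l]]) (use l in \<open>auto simp: r_def nth_append\<close>)
next
  case (col x y)
  then obtain l where l: "l < length L" "L ! l = (x, y)"
    using assms(1) by (auto simp: in_set_conv_nth)
  show ?case
    by (rule bexI[OF _ term_ops.proj[of "length L + l"]])
      (use l in \<open>auto simp: r_def nth_append\<close>)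
next
  case (comp n f hs)
  then obtain T where T: "\<forall>h \<in> set hs. T h \<in> term_ops A (length L + length L)
      \<and> (\<forall>i j. h i j = T h (r i @ r j))"
    by metis
  have "(\<lambda>xs. f (map (\<lambda>g. g xs) (map T hs))) \<in> term_ops A (length L + length L)"
    by (rule term_ops.comp[OF comp(1)]) (use comp T in auto)
  moreover have "f (map (\<lambda>h. h i j) hs) = f (map (\<lambda>g. g (r i @ r j)) (map T hs))" for i j
    using T by (auto simp: comp_def intro!: arg_cong[of _ _ f])
  ultimately show ?case by (intro bexI[rotated]) auto
qed

lemma centralizes_matrices:
  assumes "finite (universe A)" "\<beta> \<in> Con A" "centralizes A \<beta> \<beta> \<delta>"
    and "h \<in> matrices A \<beta>" "(h False False, h False True) \<in> \<delta>"
  shows "(h True False, h True True) \<in> \<delta>"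
proof -
  have sub: "\<beta> \<subseteq> universe A \<times> universe A"
    using Con_subset[OF assms(2)] by auto
  then obtain L where L: "set L = \<beta>"
    using assms(1) finite_subset finite_cartesian_product finite_list by metis
  let ?x = "map fst L" and ?y = "map snd L"
  obtain t where t: "t \<in> term_ops A (length L + length L)"
    and h: "\<And>i j. h i j = t (map (if i then snd else fst) L @ map (if j then snd else fst) L)"
    using matrices_uniform_term[OF L assms(4)] by auto
  have "?x \<in> tuples (universe A) (length L)" "?y \<in> tuples (universe A) (length L)"
    using sub L by (auto simp: tuples_def)
  moreover have "\<forall>i<length L. (?x ! i, ?y ! i) \<in> \<beta>"
    using L by auto
  ultimately have "(t (?x @ ?x), t (?x @ ?y)) \<in> \<delta> \<Longrightarrow> (t (?y @ ?x), t (?y @ ?y)) \<in> \<delta>"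
    using assms(3) t unfolding centralizes_def by blast
  then show ?thesis using assms(5) by (simp add: h)
qed

section \<open>Abelian quotients of finite Mal'cev algebras\<close>

locale finite_malcev =
  fixes A :: "'a ualgebra" and d :: "'a list \<Rightarrow> 'a"
  assumes alg: "universal_algebra A" and fin: "finite (universe A)"
    and malcev: "malcev_term_op A d"
begin

lemma d_poly: "d \<in> poly_funs A 3"
  using malcev term_op_is_poly_fun by (auto simp: malcev_term_op_def)

lemma d_right [simp]: "a \<in> universe A \<Longrightarrow> b \<in> universe A \<Longrightarrow> d [a, b, b] = a"
  and d_left [simp]: "a \<in> universe A \<Longrightarrow> b \<in> universe A \<Longrightarrow> d [b, b, a] = a"
  using malcev by (auto simp: malcev_term_op_def)

lemma d_closed [simp]:
  "x \<in> universe A \<Longrightarrow> y \<in> universe A \<Longrightarrow> z \<in> universe A \<Longrightarrow> d [x, y, z] \<in> universe A"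
  by (rule poly_funs_closed[OF alg d_poly]) (simp add: tuples_def)

lemma d_cong:
  assumes "\<theta> \<in> Con A" "(x, x') \<in> \<theta>" "(y, y') \<in> \<theta>" "(z, z') \<in> \<theta>"
  shows "(d [x, y, z], d [x', y', z']) \<in> \<theta>"
  by (rule poly_funs_cong[OF alg assms(1) d_poly])
    (use assms Con_subset[OF assms(1)] in \<open>auto simp: tuples_def nth_Cons' numeral_3_eq_3\<close>)

text \<open>
  The term condition passes from the commutator up to \<open>\<alpha>\<close>. Subtracting the first row from every row
  of \<open>h\<close> gives a matrix \<open>F\<close> whose first row is constant. The term condition modulo each \<open>\<delta>\<close> in the
  intersection that defines the commutator makes the second row of \<open>F\<close> constant modulo \<open>\<delta>\<close>. Modulo
  \<open>\<alpha>\<close> the first row of \<open>h\<close> is constant too, so the second rows of \<open>F\<close> and \<open>h\<close> agree.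
\<close>

lemma abelian_term_condition:
  assumes \<alpha>: "\<alpha> \<in> Con A" and \<beta>: "\<beta> \<in> Con A" and comm: "commutator A \<beta> \<beta> \<subseteq> \<alpha>"
    and h: "h \<in> matrices A \<beta>" and eq: "(h False False, h False True) \<in> \<alpha>"
  shows "(h True False, h True True) \<in> \<alpha>"
proof -
  let ?F = "\<lambda>i j. d [h i j, h False j, h False False]"
  have U: "h i j \<in> universe A" for i j
    by (rule matrices_closed[OF alg \<beta> h])
  have F: "?F \<in> matrices A \<beta>"
    by (rule matrices_poly3[OF \<beta> d_poly h matrices_repeat_row[OF \<beta> h] matrices_const[OF \<beta> U]])
  have "(?F True False, ?F True True) \<in> commutator A \<beta> \<beta>"
    unfolding commutator_def
  proof safe
    fix \<delta> assume \<delta>: "\<delta> \<in> Con A" "centralizes A \<beta> \<beta> \<delta>"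
    have "(?F False False, ?F False True) \<in> \<delta>"
      using U Con_refl[OF \<delta>(1)] by simp
    then show "(?F True False, ?F True True) \<in> \<delta>"
      using centralizes_matrices[OF fin \<beta> \<delta>(2) F] by simp
  qed
  then have "(h True False, ?F True True) \<in> \<alpha>"
    using comm U by auto
  moreover have "(?F True True, d [h True True, h False True, h False True]) \<in> \<alpha>"
    by (intro d_cong \<alpha> Con_refl[OF \<alpha>] U eq)
  ultimately show ?thesis
    using Con_trans[OF \<alpha>] U by simp
qed

text \<open>
  In an abelian group \<open>x - y + z = x\<close> forces \<open>y = z\<close>. Here the equation is read as
  \<open>d(x, y, z) = d(x, z, z)\<close>, and the term condition replaces the first argument \<open>x\<close> by \<open>y\<close>.
\<close>

lemma abelian_cancel:
  assumes \<alpha>: "\<alpha> \<in> Con A" and \<beta>: "\<beta> \<in> Con A" and comm: "commutator A \<beta> \<beta> \<subseteq> \<alpha>"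
    and xy: "(x, y) \<in> \<beta>" and yz: "(y, z) \<in> \<beta>" and eq: "(d [x, y, z], x) \<in> \<alpha>"
  shows "(z, y) \<in> \<alpha>"
proof -
  let ?h = "\<lambda>i j. d [if i then y else x, if j then z else y, z]"
  note U = Con_subset[OF \<beta> xy] Con_subset[OF \<beta> yz]
  have "?h \<in> matrices A \<beta>"
    using U by (intro matrices_poly3[OF \<beta> d_poly] matrices.row[OF xy] matrices.col[OF yz]
        matrices_const[OF \<beta>]) simp
  from abelian_term_condition[OF \<alpha> \<beta> comm this]
  have "(d [x, y, z], d [x, z, z]) \<in> \<alpha> \<Longrightarrow> (d [y, y, z], d [y, z, z]) \<in> \<alpha>"
    by (simp only: if_True if_False)
  then show ?thesis
    using eq U by auto
qed

text \<open>
  Let the row index switch the first argument of \<open>d\<close> from \<open>ys\<close> to \<open>xs\<close> and the column index switch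
  the third one from \<open>ys\<close> to \<open>zs\<close>. The matrices \<open>L\<close> of \<open>p(d(\<cdot>, ys, \<cdot>))\<close> and \<open>R\<close> of
  \<open>d(p(\<cdot>), p(ys), p(\<cdot>))\<close> agree as long as one of the arguments is still \<open>ys\<close>. So their difference
  is constant in three entries, and the term condition extends this to the fourth, modulo \<open>\<alpha>\<close>.
\<close>

lemma abelian_poly_affine:
  assumes \<alpha>: "\<alpha> \<in> Con A" and \<beta>: "\<beta> \<in> Con A" and comm: "commutator A \<beta> \<beta> \<subseteq> \<alpha>"
    and p: "p \<in> poly_funs A k"
    and len: "length xs = k" "length ys = k" "length zs = k"
    and xy: "\<forall>l<k. (xs ! l, ys ! l) \<in> \<beta>" and yz: "\<forall>l<k. (ys ! l, zs ! l) \<in> \<beta>"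
  shows "(d [p xs, p ys, p zs], p (map (\<lambda>l. d [xs ! l, ys ! l, zs ! l]) [0..<k])) \<in> \<alpha>"
proof -
  let ?u = "\<lambda>l (i::bool) (j::bool). if i then xs ! l else ys ! l"
  let ?v = "\<lambda>l (i::bool) (j::bool). ys ! l"
  let ?w = "\<lambda>l (i::bool) (j::bool). if j then zs ! l else ys ! l"
  let ?dm = "\<lambda>l i j. d [?u l i j, ?v l i j, ?w l i j]"
  have U: "xs ! l \<in> universe A" "ys ! l \<in> universe A" "zs ! l \<in> universe A" if "l < k" for l
    using Con_subset[OF \<beta> xy[rule_format, OF that]] Con_subset[OF \<beta> yz[rule_format, OF that]]
    by simp_all
  have u: "?u l \<in> matrices A \<beta>" if "l < k" for l
    by (rule matrices.row, rule Con_sym[OF \<beta>]) (use xy that in blast)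
  have v: "?v l \<in> matrices A \<beta>" if "l < k" for l
    by (rule matrices_const[OF \<beta> U(2)[OF that]])
  have w: "?w l \<in> matrices A \<beta>" if "l < k" for l
    by (rule matrices.col) (use yz that in blast)
  have dm: "?dm l \<in> matrices A \<beta>" if "l < k" for l
    by (rule matrices_poly3[OF \<beta> d_poly u[OF that] v[OF that] w[OF that]])
  define P where "P m i j = p (map (\<lambda>l. m l i j) [0..<k])"
    for m :: "nat \<Rightarrow> bool \<Rightarrow> bool \<Rightarrow> 'a" and i j
  have P: "P m \<in> matrices A \<beta>" if "\<And>l. l < k \<Longrightarrow> m l \<in> matrices A \<beta>" for m
  proof -
    have "(\<lambda>i j. p (map (\<lambda>h. h i j) (map m [0..<k]))) \<in> matrices A \<beta>"
      by (rule matrices_poly[OF \<beta> p]) (use that in auto)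
    then show ?thesis by (simp add: P_def[abs_def] comp_def)
  qed
  define L where "L = P ?dm"
  define R where "R i j = d [P ?u i j, P ?v i j, P ?w i j]" for i j
  have L: "L \<in> matrices A \<beta>"
    unfolding L_def by (rule P) (rule dm)
  have R: "R \<in> matrices A \<beta>"
    unfolding R_def[abs_def] by (rule matrices_poly3[OF \<beta> d_poly P P P]; use u v w in blast)
  \<comment> \<open>Any origin makes the difference \<open>L - R\<close> constant in three entries; this one turns the
    fourth entry into \<open>L True True\<close>.\<close>
  let ?o = "R True True"
  let ?M = "\<lambda>i j. d [L i j, R i j, ?o]"
  have LU: "L i j \<in> universe A" and RU: "R i j \<in> universe A" for i j
    by (rule matrices_closed[OF alg \<beta> L] matrices_closed[OF alg \<beta> R])+
  have M: "?M \<in> matrices A \<beta>"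
    by (rule matrices_poly3[OF \<beta> d_poly L R matrices_const[OF \<beta> RU]])
  have px: "map (\<lambda>l. xs ! l) [0..<k] = xs" "map (\<lambda>l. ys ! l) [0..<k] = ys"
      "map (\<lambda>l. zs ! l) [0..<k] = zs"
    using len by (auto intro: nth_equalityI)
  have pU: "p xs \<in> universe A" "p ys \<in> universe A" "p zs \<in> universe A"
    by (rule poly_funs_closed[OF alg p]; use U len in \<open>simp add: tuples_iff\<close>)+
  have LR: "L i j = R i j" if "\<not> i \<or> \<not> j" for i j
  proof -
    have "map (\<lambda>l. ?dm l i j) [0..<k] = (if i then xs else if j then zs else ys)"
      using that U len by (auto intro!: nth_equalityI)
    then have "L i j = (if i then p xs else if j then p zs else p ys)"
      by (simp add: L_def P_def)
    then show ?thesis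
      using that pU px by (cases i; cases j) (simp_all add: R_def P_def)
  qed
  have "?M i j = ?o" if "\<not> i \<or> \<not> j" for i j
    unfolding LR[OF that] by (rule d_left[OF RU RU])
  then have "(?o, ?M True True) \<in> \<alpha>"
    using abelian_term_condition[OF \<alpha> \<beta> comm M] Con_refl[OF \<alpha> RU] by simp
  moreover have "?M True True = L True True"
    by (rule d_right[OF LU RU])
  ultimately show ?thesis
    using px by (simp add: P_def L_def R_def)
qed

section \<open>Rich algebras have no abelian prime quotients\<close>

definition unit_pt :: "'a \<Rightarrow> 'a \<Rightarrow> nat \<Rightarrow> 'a list" where
  "unit_pt a b m = (replicate 5 a)[m := b]"

text \<open>
  With \<open>a\<close> as zero, \<open>d [a, b, a]\<close> is \<open>- b\<close>, and this is the alternating sum of the five points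
  \<open>unit_pt a b 0, \<dots>, unit_pt a b 4\<close>.
\<close>

definition alt_pt :: "'a \<Rightarrow> 'a \<Rightarrow> 'a list" where
  "alt_pt a b = [b, d [a, b, a], b, d [a, b, a], b]"

definition six_points :: "'a \<Rightarrow> 'a \<Rightarrow> 'a list set" where
  "six_points a b = insert (alt_pt a b) (unit_pt a b ` {..<5})"

definition six_fun :: "'a \<Rightarrow> 'a \<Rightarrow> 'a list \<Rightarrow> 'a" where
  "six_fun a b t = (if t = alt_pt a b then b else a)"

lemma unit_pt_simps:
  "unit_pt a b 0 = [b, a, a, a, a]" "unit_pt a b 1 = [a, b, a, a, a]"
  "unit_pt a b 2 = [a, a, b, a, a]" "unit_pt a b 3 = [a, a, a, b, a]"
  "unit_pt a b 4 = [a, a, a, a, b]"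
  by (simp_all add: unit_pt_def eval_nat_numeral)

lemma six_fun_unit_pt:
  assumes "a \<noteq> b" "i < 5"
  shows "six_fun a b (unit_pt a b i) = a"
proof -
  have "i \<in> {0, 1, 2, 3, 4}" using assms by auto
  then show ?thesis using assms(1) by (auto simp: unit_pt_simps alt_pt_def six_fun_def simp del: One_nat_def)
qed

text \<open>
  At the coordinates where \<open>alt_pt\<close> has the entry \<open>b\<close>, projection differs from \<open>six_fun\<close> at a single
  point.
\<close>

lemma six_fun_eq_coordinate:
  assumes "a \<noteq> b" "t \<in> six_points a b" "m \<in> {0, 2, 4}" "t \<noteq> unit_pt a b m"
  shows "t ! m = six_fun a b t"
proof (cases "t = alt_pt a b")
  case True
  then show ?thesis using assms(3) by (auto simp: alt_pt_def six_fun_def)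
next
  case False
  then obtain i where "i < 5" "t = unit_pt a b i"
    using assms(2) by (auto simp: six_points_def)
  then show ?thesis
    using False assms(3,4) by (auto simp: six_fun_def unit_pt_def nth_list_update)
qed

lemma six_fun_preserves_if_unit_pt_missing:
  assumes "a \<noteq> b" "ts \<in> tuples (six_points a b) n" "\<forall>j<5. map (\<lambda>t. t ! j) ts \<in> B"
    and "m \<in> {0, 2, 4}" "unit_pt a b m \<notin> set ts"
  shows "map (six_fun a b) ts \<in> B"
proof -
  have eq: "map (six_fun a b) ts = map (\<lambda>t. t ! m) ts"
    using six_fun_eq_coordinate[OF assms(1) _ assms(4), symmetric] assms(2,5)
    by (auto simp: tuples_def)
  have "m < 5" using assms(4) by auto
  then show ?thesis using assms(3) unfolding eq by blast
qed

text \<open>So a relation with fewer than three places cannot be violated by \<open>six_fun\<close>.\<close>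

lemma three_unit_pts:
  assumes "a \<noteq> b" "\<forall>m \<in> {0, 2, 4}. unit_pt a b m \<in> set ts"
  shows "card (set ts \<inter> unit_pt a b ` {0, 2, 4}) = 3"
proof -
  have "set ts \<inter> unit_pt a b ` {0, 2, 4} = unit_pt a b ` {0, 2, 4}"
    using assms(2) by auto
  also have "card \<dots> = 3"
    using assms(1) by (simp add: unit_pt_simps)
  finally show ?thesis .
qed

text \<open>
  A tuple of points that \<open>six_fun\<close> maps out of a relation must contain the three points
  \<open>unit_pt a b m\<close> with \<open>m\<close> even. A congruence has too few places for that. A relation \<open>rho\<close> has a
  fourth place, which has to hold \<open>alt_pt a b\<close>, as otherwise all values are \<open>a\<close>. Coordinate 1 of the
  four points then consists of one entry \<open>- b\<close> and three zeros. An affine relation between these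
  entries gives \<open>b = 0\<close> modulo \<open>\<alpha>\<close>, and then the values at all four points agree modulo \<open>\<alpha>\<close>.
\<close>

lemma six_fun_type_preserving:
  assumes ab: "a \<noteq> b" and U: "a \<in> universe A" "b \<in> universe A"
  shows "type_preserving A d 5 (six_points a b) (six_fun a b)"
  unfolding type_preserving_def congruence_preserving_def preserves_def
proof (intro conjI ballI allI impI)
  fix \<theta> ts
  assume \<theta>: "\<theta> \<in> Con A" and ts: "ts \<in> tuples (six_points a b) 2"
    and R: "\<forall>j<5. map (\<lambda>t. t ! j) ts \<in> {[a, b] |a b. (a, b) \<in> \<theta>}"
  have "card (set ts) \<le> 2"
    using ts card_length[of ts] by (simp add: tuples_def)
  then have "card (set ts \<inter> unit_pt a b ` {0, 2, 4}) \<noteq> 3"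
    using card_mono[of "set ts" "set ts \<inter> unit_pt a b ` {0, 2, 4}"] by auto
  then obtain m where "m \<in> {0, 2, 4}" "unit_pt a b m \<notin> set ts"
    using three_unit_pts[OF ab] by blast
  then show "map (six_fun a b) ts \<in> {[a, b] |a b. (a, b) \<in> \<theta>}"
    using six_fun_preserves_if_unit_pt_missing[OF ab ts R] by blast
next
  fix \<alpha> \<beta> ts
  assume cov: "covers A \<alpha> \<beta> \<and> commutator A \<beta> \<beta> \<subseteq> \<alpha>"
    and ts: "ts \<in> tuples (six_points a b) 4"
    and R: "\<forall>j<5. map (\<lambda>t. t ! j) ts \<in> rho d \<alpha> \<beta>"
  have \<alpha>: "\<alpha> \<in> Con A" and \<beta>: "\<beta> \<in> Con A" and sub: "\<alpha> \<subseteq> \<beta>" and comm: "commutator A \<beta> \<beta> \<subseteq> \<alpha>"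
    using cov by (auto simp: covers_def)
  let ?f = "six_fun a b" and ?c = "d [a, b, a]" and ?s = "alt_pt a b"
  show "map ?f ts \<in> rho d \<alpha> \<beta>"
  proof (cases "\<forall>m \<in> {0, 2, 4}. unit_pt a b m \<in> set ts")
    case False
    then show ?thesis
      using six_fun_preserves_if_unit_pt_missing[OF ab ts R] by blast
  next
    case units: True
    obtain x y z w where xyzw: "ts = [x, y, z, w]"
      using ts by (auto simp: tuples_def length_Suc_conv eval_nat_numeral)
    have trivial: ?thesis if eq: "(a, b) \<in> \<alpha>"
    proof -
      have f: "(?f t, ?f t') \<in> \<alpha>" for t t'
        using eq Con_sym[OF \<alpha> eq] Con_refl[OF \<alpha>] U by (auto simp: six_fun_def)
      have "(d [?f x, ?f y, ?f z], d [?f w, ?f w, ?f w]) \<in> \<alpha>"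
        by (intro d_cong \<alpha> f)
      moreover have "?f w \<in> universe A"
        using U by (auto simp: six_fun_def)
      ultimately show ?thesis
        using f sub xyzw by (auto simp: rho_def)
    qed
    show ?thesis
    proof (cases "?s \<in> set ts")
      case False
      then have "map ?f ts = [a, a, a, a]"
        by (auto simp: xyzw six_fun_def)
      then show ?thesis
        using U Con_refl[OF \<alpha>] Con_refl[OF \<beta>] by (auto simp: rho_def)
    next
      case s: True
      let ?E = "insert ?s (unit_pt a b ` {0, 2, 4})"
      have E4: "card ?E = 4"
        using ab by (simp add: unit_pt_simps alt_pt_def)
      have "?E = set ts"
      proof (rule card_seteq)
        show "?E \<subseteq> set ts" using units s by auto
        show "card (set ts) \<le> card ?E"
          using ts card_length[of ts] E4 by (simp add: tuples_def)
      qed simp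
      then have dist: "distinct ts" and E: "set ts = ?E"
        using E4 ts by (auto intro: card_distinct simp: tuples_def)
      have co: "t ! 1 = (if t = ?s then ?c else a)" if "t \<in> set ts" for t
        using that ab unfolding E by (auto simp: unit_pt_def alt_pt_def)
      have r1: "(x ! 1, y ! 1) \<in> \<beta>" "(y ! 1, z ! 1) \<in> \<beta>" "(d [x ! 1, y ! 1, z ! 1], w ! 1) \<in> \<alpha>"
        using R[rule_format, of 1] by (auto simp: xyzw rho_def)
      have r0: "(x ! 0, y ! 0) \<in> \<beta>" "(y ! 0, z ! 0) \<in> \<beta>" "(d [x ! 0, y ! 0, z ! 0], w ! 0) \<in> \<alpha>"
        using R[rule_format, of 0] by (auto simp: xyzw rho_def)
      \<comment> \<open>All four entries at coordinate 0 are related by \<open>\<beta>\<close>, and both \<open>a\<close> and \<open>b\<close> occur there.\<close>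
      have "(x ! 0, x ! 0) \<in> \<beta>"
        using Con_refl[OF \<beta>] Con_subset[OF \<beta> r0(1)] by blast
      moreover have "(x ! 0, z ! 0) \<in> \<beta>"
        by (rule Con_trans[OF \<beta> r0(1,2)])
      moreover from calculation have "(d [x ! 0, x ! 0, x ! 0], d [x ! 0, y ! 0, z ! 0]) \<in> \<beta>"
        by (intro d_cong \<beta> r0(1))
      then have "(x ! 0, w ! 0) \<in> \<beta>"
        using Con_trans[OF \<beta> _ subsetD[OF sub r0(3)]] Con_subset[OF \<beta> r0(1)] by simp
      ultimately have x0: "(x ! 0, t ! 0) \<in> \<beta>" if "t \<in> set ts" for t
        using that r0(1) by (auto simp: xyzw)
      have "(unit_pt a b 2 ! 0, unit_pt a b 0 ! 0) \<in> \<beta>"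
        by (rule Con_trans[OF \<beta> Con_sym[OF \<beta> x0] x0]) (use units in auto)
      then have "(a, b) \<in> \<beta>"
        by (simp add: unit_pt_simps)
      then have ca: "(?c, a) \<in> \<beta>"
        using d_cong[OF \<beta> _ Con_sym[OF \<beta> \<open>(a, b) \<in> \<beta>\<close>], of a a a a] Con_refl[OF \<beta> U(1)] U by simp
      have cU: "?c \<in> universe A" using U by simp
      consider "x = ?s" | "y = ?s" | "z = ?s" | "w = ?s"
        using s by (auto simp: xyzw)
      then have "(?c, a) \<in> \<alpha>"
      proof cases
        case 1
        then have "y ! 1 = a" "z ! 1 = a" "w ! 1 = a" "x ! 1 = ?c"
          using co dist by (auto simp: xyzw)
        then show ?thesis using r1(3) U cU by simp
      next
        case 2
        then have "x ! 1 = a" "z ! 1 = a" "w ! 1 = a" "y ! 1 = ?c"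
          using co dist by (auto simp: xyzw)
        then have "(d [a, ?c, a], a) \<in> \<alpha>" using r1(3) by simp
        then show ?thesis
          using abelian_cancel[OF \<alpha> \<beta> comm Con_sym[OF \<beta> ca] ca] Con_sym[OF \<alpha>] by blast
      next
        case 3
        then have "x ! 1 = a" "y ! 1 = a" "w ! 1 = a" "z ! 1 = ?c"
          using co dist by (auto simp: xyzw)
        then show ?thesis using r1(3) U cU by simp
      next
        case 4
        then have "x ! 1 = a" "y ! 1 = a" "z ! 1 = a" "w ! 1 = ?c"
          using co dist by (auto simp: xyzw)
        then show ?thesis using r1(3) U Con_sym[OF \<alpha>] by simp
      qed
      then have "(a, b) \<in> \<alpha>"
        using abelian_cancel[OF \<alpha> \<beta> comm \<open>(a, b) \<in> \<beta>\<close> Con_sym[OF \<beta> \<open>(a, b) \<in> \<beta>\<close>]] by blast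
      then show ?thesis by (rule trivial)
    qed
  qed
qed

text \<open>
  A polynomial that extends \<open>six_fun\<close> is affine modulo \<open>\<alpha>\<close> on the class of \<open>a\<close>, so its value at the
  alternating sum of the points \<open>unit_pt a b i\<close> is the alternating sum \<open>a\<close> of its values there; but
  the value at that point is \<open>b\<close>.
\<close>

lemma rich_no_abelian_cover:
  assumes rich: "strictly_polynomially_rich A d 5" and cov: "covers A \<alpha> \<beta>"
  shows "\<not> commutator A \<beta> \<beta> \<subseteq> \<alpha>"
proof
  assume comm: "commutator A \<beta> \<beta> \<subseteq> \<alpha>"
  have \<alpha>: "\<alpha> \<in> Con A" and \<beta>: "\<beta> \<in> Con A"
    using cov by (auto simp: covers_def)
  obtain a b where ab: "(a, b) \<in> \<beta>" "(a, b) \<notin> \<alpha>"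
    using cov by (auto simp: covers_def)
  have U: "a \<in> universe A" "b \<in> universe A"
    using Con_subset[OF \<beta> ab(1)] by auto
  have neq: "a \<noteq> b"
    using ab Con_refl[OF \<alpha> U(1)] by auto
  let ?c = "d [a, b, a]" and ?e = "unit_pt a b"
  have "alt_pt a b \<in> tuples (universe A) 5"
    using U by (simp add: alt_pt_def tuples_def)
  moreover have "unit_pt a b i \<in> tuples (universe A) 5" for i
    using U set_update_subset_insert[of "replicate 5 a" i b] by (auto simp: tuples_def unit_pt_def)
  ultimately have "six_points a b \<subseteq> tuples (universe A) 5"
    by (auto simp: six_points_def)
  moreover have "six_fun a b ` six_points a b \<subseteq> universe A"
    using U by (auto simp: six_fun_def)
  ultimately obtain p where p: "p \<in> poly_funs A 5" "\<forall>t \<in> six_points a b. p t = six_fun a b t"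
    using rich six_fun_type_preserving[OF neq U] unfolding strictly_polynomially_rich_def by blast
  have pe: "p (?e i) = a" if "i < 5" for i
    using p(2) six_fun_unit_pt[OF neq that] that by (auto simp: six_points_def)
  have ps: "p (alt_pt a b) = b"
    using p(2) by (simp add: six_points_def six_fun_def)
  \<comment> \<open>The partial sum \<open>e\<^sub>0 - e\<^sub>1 + e\<^sub>2\<close>.\<close>
  let ?q = "[b, ?c, b, a, a]"
  have aa: "(a, a) \<in> \<beta>" "(b, a) \<in> \<beta>" "(a, ?c) \<in> \<beta>" "(?c, a) \<in> \<beta>"
  proof -
    show aa: "(a, a) \<in> \<beta>" "(b, a) \<in> \<beta>"
      using U ab(1) Con_refl[OF \<beta>] Con_sym[OF \<beta>] by auto
    have "(d [a, b, a], d [a, a, a]) \<in> \<beta>"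
      by (intro d_cong \<beta> aa)
    then show "(a, ?c) \<in> \<beta>" "(?c, a) \<in> \<beta>"
      using U Con_sym[OF \<beta>] by auto
  qed
  have "(d [p (?e 0), p (?e 1), p (?e 2)],
      p (map (\<lambda>l. d [?e 0 ! l, ?e 1 ! l, ?e 2 ! l]) [0..<5])) \<in> \<alpha>"
    by (rule abelian_poly_affine[OF \<alpha> \<beta> comm p(1)])
      (use aa ab in \<open>auto simp: unit_pt_def nth_list_update\<close>)
  also have "map (\<lambda>l. d [?e 0 ! l, ?e 1 ! l, ?e 2 ! l]) [0..<5] = ?q"
    using U by (simp add: unit_pt_simps upt_rec del: One_nat_def)
  finally have 1: "(a, p ?q) \<in> \<alpha>"
    using U pe by simp
  have "(d [p ?q, p (?e 3), p (?e 4)],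
      p (map (\<lambda>l. d [?q ! l, ?e 3 ! l, ?e 4 ! l]) [0..<5])) \<in> \<alpha>"
    by (rule abelian_poly_affine[OF \<alpha> \<beta> comm p(1)])
      (use aa ab in \<open>auto simp: unit_pt_def nth_list_update nth_Cons' numeral_eq_Suc less_Suc_eq\<close>)
  also have "map (\<lambda>l. d [?q ! l, ?e 3 ! l, ?e 4 ! l]) [0..<5] = alt_pt a b"
    using U by (simp add: unit_pt_simps alt_pt_def upt_rec del: One_nat_def)
  finally have "(p ?q, b) \<in> \<alpha>"
    using U pe ps Con_subset[OF \<alpha> 1] by simp
  from Con_trans[OF \<alpha> 1 this] ab(2) show False by simp
qed

section \<open>Interpolation by a majority polynomial\<close>

text \<open>
  Each triple with a repeated entry has its majority value at two of the three places. Two such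
  triples therefore have a common place with this property, and projection to it shows that the
  partial majority function preserves every binary relation. To make it a function of five variables
  the first entry is repeated.
\<close>

lemma rich_majority_polynomial:
  assumes "strictly_polynomially_rich A d 5"
  obtains m where "m \<in> poly_funs A 3"
    and "\<And>x y. x \<in> universe A \<Longrightarrow> y \<in> universe A \<Longrightarrow>
      m [x, x, y] = x \<and> m [x, y, x] = x \<and> m [y, x, x] = x"
proof -
  define T where "T = {[x, y, z, x, x] | x y z. x \<in> universe A \<and> y \<in> universe A \<and> z \<in> universe A
    \<and> (x = y \<or> x = z \<or> y = z)}"
  let ?f = "\<lambda>t :: 'a list. if t ! 1 = t ! 2 then t ! 1 else t ! 0"
  have "congruence_preserving A 5 T ?f"
    unfolding congruence_preserving_def preserves_def
  proof (intro ballI impI)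
    fix \<theta> ts
    assume \<theta>: "\<theta> \<in> Con A" and ts: "ts \<in> tuples T 2"
      and R: "\<forall>j<5. map (\<lambda>t. t ! j) ts \<in> {[a, b] |a b. (a, b) \<in> \<theta>}"
    have "length ts = Suc (Suc 0)" "set ts \<subseteq> T"
      using ts by (simp_all add: tuples_def)
    then obtain t u where tu: "ts = [t, u]" "t \<in> T" "u \<in> T"
      by (auto simp: length_Suc_conv)
    have "(t ! j, u ! j) \<in> \<theta>" if "j < 5" for j
      using R[rule_format, OF that] by (simp add: tu)
    moreover have "\<exists>j \<in> {0, 1, 2}. ?f t = t ! j \<and> ?f u = u ! j"
    proof -
      obtain x y z x' y' z' where "t = [x, y, z, x, x]" "u = [x', y', z', x', x']"
        "x = y \<or> x = z \<or> y = z" "x' = y' \<or> x' = z' \<or> y' = z'"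
        using tu(2,3) unfolding T_def by blast
      then show ?thesis by (cases "y = z"; cases "y' = z'") auto
    qed
    ultimately have "(?f t, ?f u) \<in> \<theta>"
      by (elim bexE conjE) auto
    then show "map ?f ts \<in> {[a, b] |a b. (a, b) \<in> \<theta>}"
      by (simp add: tu)
  qed
  then have "type_preserving A d 5 T ?f"
    using rich_no_abelian_cover[OF assms] by (auto simp: type_preserving_def)
  moreover have "T \<subseteq> tuples (universe A) 5" "?f ` T \<subseteq> universe A"
    by (auto simp: tuples_def T_def)
  ultimately have "\<exists>p \<in> poly_funs A 5. \<forall>t \<in> T. p t = ?f t"
    using assms[unfolded strictly_polynomially_rich_def, rule_format, of T ?f] by simp
  then obtain p where p: "p \<in> poly_funs A 5" and pT: "\<And>t. t \<in> T \<Longrightarrow> p t = ?f t"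
    by blast
  let ?g = "\<lambda>i xs. xs ! i"
  have "(\<lambda>xs. p (map (\<lambda>g. g xs) [?g 0, ?g 1, ?g 2, ?g 0, ?g 0])) \<in> poly_funs A 3"
    by (rule poly_funs_compose[OF p]) (auto intro!: poly_funs.proj)
  moreover have "p [x, x, y, x, x] = x \<and> p [x, y, x, x, x] = x \<and> p [y, x, x, y, y] = x"
    if "x \<in> universe A" "y \<in> universe A" for x y
  proof -
    have "[x, x, y, x, x] \<in> T" "[x, y, x, x, x] \<in> T" "[y, x, x, y, y] \<in> T"
      using that by (auto simp: T_def)
    from this[THEN pT] show ?thesis by auto
  qed
  ultimately show ?thesis
    by (intro that) auto
qed

text \<open>
  The pairs of values of polynomials at \<open>t\<close> and \<open>s\<close> form a reflexive relation compatible with the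
  operations. The Mal'cev operation makes it symmetric, by applying \<open>d\<close> to the pairs \<open>(x, x)\<close>,
  \<open>(x, y)\<close>, \<open>(y, y)\<close>, and transitive, by applying it to \<open>(x, y)\<close>, \<open>(y, y)\<close>, \<open>(y, z)\<close>.
  So this congruence, which contains all pairs \<open>(t ! i, s ! i)\<close>, also contains \<open>(a, b)\<close>.
\<close>

lemma two_point_interpolation:
  assumes t: "t \<in> tuples (universe A) k" and s: "s \<in> tuples (universe A) k"
    and ab: "\<And>\<theta>. \<theta> \<in> Con A \<Longrightarrow> \<forall>i<k. (t ! i, s ! i) \<in> \<theta> \<Longrightarrow> (a, b) \<in> \<theta>"
  shows "\<exists>p \<in> poly_funs A k. p t = a \<and> p s = b"
proof -
  define S where "S = {(p t, p s) | p. p \<in> poly_funs A k}"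
  have SI: "p \<in> poly_funs A k \<Longrightarrow> (p t, p s) \<in> S" for p
    by (auto simp: S_def)
  have d3: "(d [x, y, z], d [x', y', z']) \<in> S" if xyz: "(x, x') \<in> S" "(y, y') \<in> S" "(z, z') \<in> S"
    for x y z x' y' z'
  proof -
    obtain g1 g2 g3 where g: "g1 \<in> poly_funs A k" "g2 \<in> poly_funs A k" "g3 \<in> poly_funs A k"
      and "x = g1 t" "x' = g1 s" "y = g2 t" "y' = g2 s" "z = g3 t" "z' = g3 s"
      using xyz by (auto simp: S_def)
    then show ?thesis
      using SI[OF poly_funs_compose3[OF d_poly g]] by simp
  qed
  have sub: "S \<subseteq> universe A \<times> universe A"
    using poly_funs_closed[OF alg] t s by (auto simp: S_def)
  have rfl: "(x, x) \<in> S" if "x \<in> universe A" for x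
    using SI[OF poly_funs.const[OF that]] by simp
  have sy: "(y, x) \<in> S" if "(x, y) \<in> S" for x y
    using d3[OF rfl[of x] that rfl[of y]] that sub by auto
  have tr: "(x, z) \<in> S" if "(x, y) \<in> S" "(y, z) \<in> S" for x y z
    using d3[OF that(1) rfl[of y] that(2)] that d_left d_right sub by (metis mem_Sigma_iff subsetD)
  have "S \<in> Con A"
    unfolding Con_def
  proof (intro CollectI conjI ballI impI)
    show "equiv (universe A) S"
      by (intro equivI sub refl_onI symI transI) (fact rfl sy tr)+
  next
    fix nf assume "nf \<in> basic_ops A"
    then show "case nf of (n, f) \<Rightarrow> \<forall>xs \<in> tuples (universe A) n. \<forall>ys \<in> tuples (universe A) n.
        (\<forall>i<n. (xs ! i, ys ! i) \<in> S) \<longrightarrow> (f xs, f ys) \<in> S"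
    proof (cases nf, clarsimp)
      fix n f xs ys
      assume nf: "(n, f) \<in> basic_ops A" and len: "xs \<in> tuples (universe A) n" "ys \<in> tuples (universe A) n"
        and rel: "\<forall>i<n. (xs ! i, ys ! i) \<in> S"
      have "\<forall>i<n. \<exists>g. g \<in> poly_funs A k \<and> xs ! i = g t \<and> ys ! i = g s"
        using rel by (auto simp: S_def)
      then obtain g where g: "\<forall>i<n. g i \<in> poly_funs A k \<and> xs ! i = g i t \<and> ys ! i = g i s"
        by metis
      have "(\<lambda>us. f (map (\<lambda>g. g us) (map g [0..<n]))) \<in> poly_funs A k"
        by (rule poly_funs.comp[OF nf]) (use g in auto)
      moreover have "map (\<lambda>g. g t) (map g [0..<n]) = xs" "map (\<lambda>g. g s) (map g [0..<n]) = ys"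
        using g len by (auto intro!: nth_equalityI simp: tuples_def)
      ultimately show "(f xs, f ys) \<in> S"
        using SI by metis
    qed
  qed
  moreover have "\<forall>i<k. (t ! i, s ! i) \<in> S"
    using SI poly_funs.proj by metis
  ultimately have "(a, b) \<in> S" by (rule ab)
  then show ?thesis by (auto simp: S_def)
qed

text \<open>
  Given three points \<open>x, y, z\<close> of \<open>V\<close>, interpolate \<open>f\<close> on each of \<open>V - {x}\<close>, \<open>V - {y}\<close> and
  \<open>V - {z}\<close>. At every point of \<open>V\<close> at least two of the three interpolants have the right value, so
  their majority has it too.
\<close>

lemma majority_interpolation:
  assumes m: "m \<in> poly_funs A 3"
    and maj: "\<And>x y. x \<in> universe A \<Longrightarrow> y \<in> universe A \<Longrightarrow>
      m [x, x, y] = x \<and> m [x, y, x] = x \<and> m [y, x, x] = x"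
    and T: "T \<subseteq> tuples (universe A) k" and f: "f ` T \<subseteq> universe A"
    and two: "\<And>t s. t \<in> T \<Longrightarrow> s \<in> T \<Longrightarrow> \<exists>p \<in> poly_funs A k. p t = f t \<and> p s = f s"
    and "finite V" "V \<subseteq> T"
  shows "\<exists>p \<in> poly_funs A k. \<forall>t \<in> V. p t = f t"
  using \<open>finite V\<close> \<open>V \<subseteq> T\<close>
proof (induction V rule: finite_psubset_induct)
  case (psubset V)
  show ?case
  proof (cases "\<exists>t s. V \<subseteq> {t, s}")
    case True
    show ?thesis
    proof (cases "V = {}")
      case True
      then show ?thesis
        using alg poly_funs.const by (fastforce simp: universal_algebra_def)
    next
      case False
      with \<open>\<exists>t s. V \<subseteq> {t, s}\<close> obtain t s where "V = {t, s}" by blast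
      then show ?thesis using two[of t s] psubset.prems by auto
    qed
  next
    case False
    then obtain x where x: "x \<in> V" by blast
    with False obtain y where y: "y \<in> V" "y \<noteq> x" by blast
    with False obtain z where z: "z \<in> V" "z \<noteq> x" "z \<noteq> y" by blast
    have "\<exists>p \<in> poly_funs A k. \<forall>t \<in> V - {u}. p t = f t" if "u \<in> V" for u
      using psubset.IH[of "V - {u}"] psubset.prems that by blast
    then obtain p where p: "\<And>u. u \<in> V \<Longrightarrow> p u \<in> poly_funs A k"
      "\<And>u t. u \<in> V \<Longrightarrow> t \<in> V - {u} \<Longrightarrow> p u t = f t"
      by metis
    have "(\<lambda>xs. m [p x xs, p y xs, p z xs]) \<in> poly_funs A k"
      by (intro poly_funs_compose3 m p x y z)
    moreover have "m [p x t, p y t, p z t] = f t" if t: "t \<in> V" for t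
    proof -
      have U: "f t \<in> universe A" "p u t \<in> universe A" if "u \<in> V" for u
        using f T t psubset.prems poly_funs_closed[OF alg p(1)[OF that]] by auto
      consider "t \<noteq> x" "t \<noteq> y" | "t \<noteq> x" "t \<noteq> z" | "t \<noteq> y" "t \<noteq> z"
        using y z by blast
      then show ?thesis
        using p(2) x y z t U maj by cases auto
    qed
    ultimately show ?thesis by (intro bexI[rotated]) auto
  qed
qed

end

theorem corollary2p3:
  fixes A :: "'a ualgebra" and d :: "'a list \<Rightarrow> 'a"
  assumes "universal_algebra A" and "finite (universe A)"
    and "malcev_term_op A d"
    and "strictly_polynomially_rich A d 5"
  shows "strictly_affine_complete A"
proof -
  interpret finite_malcev A d
    using assms by unfold_locales
  obtain m where m: "m \<in> poly_funs A 3"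
    "\<And>x y. x \<in> universe A \<Longrightarrow> y \<in> universe A \<Longrightarrow>
      m [x, x, y] = x \<and> m [x, y, x] = x \<and> m [y, x, x] = x"
    using rich_majority_polynomial[OF assms(4)] by blast
  show ?thesis
    unfolding strictly_affine_complete_def
  proof (intro allI impI)
    fix k T f
    assume asm: "T \<subseteq> tuples (universe A) k \<and> f ` T \<subseteq> universe A \<and> congruence_preserving A k T f"
    have "finite T"
      using asm finite_lists_length_eq[OF fin, of k]
      by (auto simp: tuples_def conj_commute intro: finite_subset)
    moreover have "\<exists>p \<in> poly_funs A k. p t = f t \<and> p s = f s" if ts: "t \<in> T" "s \<in> T" for t s
    proof (rule two_point_interpolation)
      fix \<theta> assume \<theta>: "\<theta> \<in> Con A" "\<forall>i<k. (t ! i, s ! i) \<in> \<theta>"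
      have "[t, s] \<in> tuples T 2" using ts by (simp add: tuples_def)
      moreover have "\<forall>j<k. map (\<lambda>t. t ! j) [t, s] \<in> {[a, b] |a b. (a, b) \<in> \<theta>}"
        using \<theta>(2) by simp
      ultimately have "map f [t, s] \<in> {[a, b] |a b. (a, b) \<in> \<theta>}"
        using asm \<theta>(1) unfolding congruence_preserving_def preserves_def by blast
      then show "(f t, f s) \<in> \<theta>" by simp
    qed (use asm ts in auto)
    ultimately show "\<exists>p \<in> poly_funs A k. \<forall>x \<in> T. p x = f x"
      using asm by (intro majority_interpolation[OF m, where T = T]) auto
  qed
qed

end
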